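(* Let $X$ be a finite set, let $\Gamma=\{A_1,\dots,A_n\}$ be a spanning graph on $X$, and let $\mathcal{M}_\Gamma$ be its canonical matrix, an $n\times n$ matrix over the ring of partials $\Pi(X)$. Then, as subsets of the symmetric group $S_X$, $$Aut(\Gamma)=\det(\mathcal{M}_\Gamma).$$
   Context: A graph on $X$ is a set $\Gamma$ of 2-element subsets (edges) of $X$; it is spanning if every point of $X$ lies in some edge. $Aut(\Gamma)=\{g\in S_X : g(A)\in\Gamma \text{ for all } A\in\Gamma\}$. A partial $\pi$ on $X$ is an injective function from a subset of $X$ to $X$; its class is $[\pi]=\{g\in S_X : g \text{ restricts to } \pi \text{ on the domain of }\pi\}$. The ring of partials $\Pi(X)$ is the power set of $S_X$, with addition the symmetric difference and multiplication the intersection ($0=\emptyset$, $1=S_X$); it is a commutative $\mathbb{F}_2$-algebra. A partial $\pi$ is identified with $[\pi]\in\Pi(X)$. Write $A_l=\{\mu_l,\nu_l\}$. The canonical matrix $\mathcal{M}_\Gamma$ is the $n\times n$ matrix with $(i,j)$ entry $\alpha^i_j\beta^i_j+\gamma^i_j\zeta^i_j$, where $\alpha^i_j,\beta^i_j,\gamma^i_j,\zeta^i_j$ are the partials with one-point domain given respectively by $\mu_i\mapsto\mu_j$, $\nu_i\mapsto\nu_j$, $\mu_i\mapsto\nu_j$, $\nu_i\mapsto\mu_j$. For an $n\times n$ matrix $(a_{i,j})$ over $\Pi(X)$, $\det((a_{i,j}))=\sum_{\rho\in \mathcal{S}_n}\prod_{i=1}^n a_{i,\rho(i)}$, with sum and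 product those of $\Pi(X)$ (no signs, since $1=-1$; the empty determinant is $1$). *)

theory Defs
  imports "HOL-Algebra.Ring" "HOL-Combinatorics.Permutations"
begin

text \<open>The symmetric group on \<open>X\<close> is rendered by \<open>permutes\<close>: bijections of \<open>X\<close>, as total functions
  fixing every point of the ambient type outside \<open>X\<close>.\<close>

definition sym_on :: "'a set \<Rightarrow> ('a \<Rightarrow> 'a) set" where
  "sym_on X = {g. g permutes X}"


definition graph_on :: "'a set \<Rightarrow> 'a set set \<Rightarrow> bool" where
  "graph_on X \<Gamma> \<longleftrightarrow> (\<forall>A\<in>\<Gamma>. A \<subseteq> X \<and> card A = 2)"

definition spanning :: "'a set \<Rightarrow> 'a set set \<Rightarrow> bool" where
  "spanning X \<Gamma> \<longleftrightarrow> (\<forall>x\<in>X. \<exists>A\<in>\<Gamma>. x \<in> A)"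

definition Aut :: "'a set \<Rightarrow> 'a set set \<Rightarrow> ('a \<Rightarrow> 'a) set" where
  "Aut X \<Gamma> = {g \<in> sym_on X. \<forall>A\<in>\<Gamma>. g ` A \<in> \<Gamma>}"


definition is_partial :: "'a set \<Rightarrow> ('a \<rightharpoonup> 'a) \<Rightarrow> bool" where
  "is_partial X p \<longleftrightarrow> dom p \<subseteq> X \<and> ran p \<subseteq> X \<and> inj_on p (dom p)"

definition partial_class :: "'a set \<Rightarrow> ('a \<rightharpoonup> 'a) \<Rightarrow> ('a \<Rightarrow> 'a) set" where
  "partial_class X p = {g \<in> sym_on X. \<forall>x\<in>dom p. p x = Some (g x)}"

definition partials_ring :: "'a set \<Rightarrow> ('a \<Rightarrow> 'a) set ring" where
  "partials_ring X =
    \<lparr>carrier = Pow (sym_on X), monoid.mult = (\<inter>), one = sym_on X, zero = {}, add = sym_diff\<rparr>"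

lemma cring_partials_ring: "cring (partials_ring X)"
proof (rule cringI)
  show "abelian_group (partials_ring X)"
  proof (rule abelian_groupI)
    fix a assume "a \<in> carrier (partials_ring X)"
    then show "\<exists>b\<in>carrier (partials_ring X).
        b \<oplus>\<^bsub>partials_ring X\<^esub> a = \<zero>\<^bsub>partials_ring X\<^esub>"
      by (intro bexI[of _ a]) (auto simp: partials_ring_def)
  qed (auto simp: partials_ring_def)
  show "comm_monoid (partials_ring X)"
    by (rule comm_monoidI) (auto simp: partials_ring_def)
qed (auto simp: partials_ring_def)

lemma is_partial_single: "x \<in> X \<Longrightarrow> y \<in> X \<Longrightarrow> is_partial X [x \<mapsto> y]"
  by (auto simp: is_partial_def)

lemma partial_class_in_carrier: "partial_class X p \<in> carrier (partials_ring X)"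
  by (auto simp: partial_class_def partials_ring_def)


text \<open>Square matrices of size \<open>n\<close> are functions of two indices in \<open>{1..n}\<close>. There are no signs in
  the determinant, since \<open>1 = -1\<close> in the ring of partials.\<close>

definition partials_det :: "'a set \<Rightarrow> nat \<Rightarrow> (nat \<Rightarrow> nat \<Rightarrow> ('a \<Rightarrow> 'a) set) \<Rightarrow> ('a \<Rightarrow> 'a) set" where
  "partials_det X n M =
    (\<Oplus>\<^bsub>partials_ring X\<^esub>\<rho>\<in>{\<rho>. \<rho> permutes {1..n}}.
      (\<Otimes>\<^bsub>partials_ring X\<^esub>i\<in>{1..n}. M i (\<rho> i)))"

text \<open>The canonical matrix of the graph with edges \<open>A\<^sub>i = {\<mu> i, \<nu> i}\<close>; it depends on the enumeration of
  the edges and on the labelling of their endpoints. Its four partials are, in order of occurrence,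
  \<open>\<alpha>\<close>, \<open>\<beta>\<close>, \<open>\<gamma>\<close> and \<open>\<zeta>\<close>.\<close>

definition canonical_matrix ::
    "'a set \<Rightarrow> (nat \<Rightarrow> 'a) \<Rightarrow> (nat \<Rightarrow> 'a) \<Rightarrow> nat \<Rightarrow> nat \<Rightarrow> ('a \<Rightarrow> 'a) set" where
  "canonical_matrix X \<mu> \<nu> i j =
    (partial_class X [\<mu> i \<mapsto> \<mu> j] \<otimes>\<^bsub>partials_ring X\<^esub> partial_class X [\<nu> i \<mapsto> \<nu> j])
    \<oplus>\<^bsub>partials_ring X\<^esub>
    (partial_class X [\<mu> i \<mapsto> \<nu> j] \<otimes>\<^bsub>partials_ring X\<^esub> partial_class X [\<nu> i \<mapsto> \<mu> j])"

end

theory Submission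
  imports Defs
begin

text \<open>The determinant is a Boolean expression in subsets of the symmetric group, so it suffices to
  ask which permutations \<open>g\<close> of \<open>X\<close> belong to it. The two summands of the entry at \<open>(i,j)\<close> are the two
  ways in which \<open>g\<close> can carry the edge \<open>A\<^sub>i\<close> onto the edge \<open>A\<^sub>j\<close>. They exclude each other because the
  endpoints of \<open>A\<^sub>j\<close> differ, so their symmetric difference is a union, and the entry is the set of
  all \<open>g\<close> with \<open>g(A\<^sub>i) = A\<^sub>j\<close> (lemma \<open>canonical_matrix_eq\<close>). A product in the ring of partials is an
  intersection; hence the product that belongs to \<open>\<rho>\<close> consists of the \<open>g\<close> that move the edges as
  \<open>\<rho>\<close> moves their indices.

  Distinct indices name distinct edges, so one \<open>g\<close> cannot do this for two different \<open>\<rho>\<close>: the summands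
  of the determinant are disjoint, and their sum modulo 2 is again their union. Finally, an element
  of \<open>S\<^sub>X\<close> is injective on subsets of \<open>X\<close>; if it maps the finite set \<open>\<Gamma>\<close> into itself, it permutes
  \<open>\<Gamma>\<close>, and so it comes from some \<open>\<rho>\<close> (lemma \<open>permutation_of_indices\<close>). The union is
  therefore \<open>Aut(\<Gamma>)\<close>.\<close>

text \<open>Without the bound \<open>g \<in> sym_on X\<close> the right-hand side would be wrong for empty \<open>I\<close>, where the
  product is the unit \<open>S\<^sub>X\<close>; this is the case of a graph without edges.\<close>

lemma finprod_partials_ring:
  assumes "finite I" and "\<And>i. i \<in> I \<Longrightarrow> f i \<subseteq> sym_on X"
  shows "(\<Otimes>\<^bsub>partials_ring X\<^esub>i\<in>I. f i) = {g \<in> sym_on X. \<forall>i\<in>I. g \<in> f i}"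
proof -
  interpret cring "partials_ring X" by (rule cring_partials_ring)
  show ?thesis
    using assms
  proof (induction I)
    case empty
    show ?case using finprod_empty by (simp add: partials_ring_def)
  next
    case (insert k I)
    have f: "f \<in> I \<rightarrow> carrier (partials_ring X)" "f k \<in> carrier (partials_ring X)"
      using insert.prems by (auto simp: partials_ring_def)
    have "(\<Otimes>\<^bsub>partials_ring X\<^esub>i\<in>insert k I. f i) = f k \<inter> (\<Otimes>\<^bsub>partials_ring X\<^esub>i\<in>I. f i)"
      using finprod_insert[OF insert.hyps f] by (simp add: partials_ring_def)
    then show ?case using insert by auto
  qed
qed

text \<open>Addition modulo 2 only cancels what is counted more than once, and a disjoint family counts
  nothing twice.\<close>

lemma finsum_partials_ring_disjoint:
  assumes "finite I" and "\<And>i. i \<in> I \<Longrightarrow> f i \<subseteq> sym_on X" and "disjoint_family_on f I"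
  shows "(\<Oplus>\<^bsub>partials_ring X\<^esub>i\<in>I. f i) = (\<Union>i\<in>I. f i)"
proof -
  interpret cring "partials_ring X" by (rule cring_partials_ring)
  show ?thesis
    using assms
  proof (induction I)
    case empty
    show ?case using finsum_empty by (simp add: partials_ring_def)
  next
    case (insert k I)
    have f: "f \<in> I \<rightarrow> carrier (partials_ring X)" "f k \<in> carrier (partials_ring X)"
      using insert.prems(1) by (auto simp: partials_ring_def)
    have "(\<Oplus>\<^bsub>partials_ring X\<^esub>i\<in>insert k I. f i) = sym_diff (f k) (\<Oplus>\<^bsub>partials_ring X\<^esub>i\<in>I. f i)"
      using finsum_insert[OF insert.hyps f] by (simp add: partials_ring_def)
    also have "(\<Oplus>\<^bsub>partials_ring X\<^esub>i\<in>I. f i) = (\<Union>i\<in>I. f i)"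
      using insert.prems by (intro insert.IH) (auto simp: disjoint_family_on_def)
    also have "sym_diff (f k) (\<Union>i\<in>I. f i) = (\<Union>i\<in>insert k I. f i)"
    proof -
      have "f k \<inter> (\<Union>i\<in>I. f i) = {}"
        using insert.prems(2) insert.hyps(2) by (fastforce simp: disjoint_family_on_def)
      then show ?thesis by auto
    qed
    finally show ?case .
  qed
qed

text \<open>If \<open>\<mu> j = \<nu> j\<close>, the two summands coincide and cancel to \<open>0\<close>, whatever the right-hand side is;
  otherwise no \<open>g\<close> can send \<open>\<mu> i\<close> to both endpoints, and the summands are disjoint.\<close>

lemma canonical_matrix_eq:
  assumes "\<mu> j \<noteq> \<nu> j"
  shows "canonical_matrix X \<mu> \<nu> i j = {g \<in> sym_on X. g ` {\<mu> i, \<nu> i} = {\<mu> j, \<nu> j}}"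
proof -
  let ?C = "\<lambda>y z. {g \<in> sym_on X. g (\<mu> i) = y \<and> g (\<nu> i) = z}"
  have C: "partial_class X [\<mu> i \<mapsto> y] \<inter> partial_class X [\<nu> i \<mapsto> z] = ?C y z" for y z
    by (auto simp: partial_class_def)
  have "canonical_matrix X \<mu> \<nu> i j = sym_diff (?C (\<mu> j) (\<nu> j)) (?C (\<nu> j) (\<mu> j))"
    unfolding canonical_matrix_def by (simp add: partials_ring_def C)
  also have "\<dots> = ?C (\<mu> j) (\<nu> j) \<union> ?C (\<nu> j) (\<mu> j)"
  proof -
    have "?C (\<mu> j) (\<nu> j) \<inter> ?C (\<nu> j) (\<mu> j) = {}" using assms by auto
    then show ?thesis by blast
  qed
  also have "\<dots> = {g \<in> sym_on X. g ` {\<mu> i, \<nu> i} = {\<mu> j, \<nu> j}}"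
    by (simp add: doubleton_eq_iff Collect_disj_eq[symmetric] conj_disj_distribL)
  finally show ?thesis .
qed

text \<open>An injection of a finite set into itself is a permutation, and an enumeration of the set turns
  it into a permutation of the indices.\<close>

lemma permutation_of_indices:
  assumes "finite I" and A: "bij_betw A I \<Gamma>" and inj: "inj_on F \<Gamma>" and F: "F ` \<Gamma> \<subseteq> \<Gamma>"
  shows "\<exists>\<rho>. \<rho> permutes I \<and> (\<forall>i\<in>I. F (A i) = A (\<rho> i))"
proof (intro exI conjI ballI)
  define \<rho> where "\<rho> = (\<lambda>i. if i \<in> I then the_inv_into I A (F (A i)) else i)"
  have "finite \<Gamma>"
    using assms(1) A by (simp add: bij_betw_finite)
  then have "bij_betw F \<Gamma> \<Gamma>"
    using inj F by (simp add: bij_betw_def endo_inj_surj)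
  with A bij_betw_the_inv_into[OF A] have "bij_betw (the_inv_into I A \<circ> (F \<circ> A)) I I"
    by (blast intro: bij_betw_trans)
  then have "bij_betw \<rho> I I"
    by (rule bij_betw_cong[THEN iffD1, rotated]) (simp add: \<rho>_def)
  then show "\<rho> permutes I"
    by (rule bij_imp_permutes) (simp add: \<rho>_def)
  show "F (A i) = A (\<rho> i)" if "i \<in> I" for i
  proof -
    have "F (A i) \<in> \<Gamma>" using that A F by (auto simp: bij_betw_def)
    then show ?thesis using that A by (simp add: \<rho>_def f_the_inv_into_f_bij_betw)
  qed
qed

theorem theorem4p2:
  fixes X :: "'a set" and \<Gamma> :: "'a set set" and n :: nat
    and A :: "nat \<Rightarrow> 'a set" and \<mu> \<nu> :: "nat \<Rightarrow> 'a"
  assumes "finite X"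
    and "graph_on X \<Gamma>"
    and "spanning X \<Gamma>"
    and "bij_betw A {1..n} \<Gamma>"
    and "\<And>l. l \<in> {1..n} \<Longrightarrow> A l = {\<mu> l, \<nu> l}"
  shows "Aut X \<Gamma> = partials_det X n (canonical_matrix X \<mu> \<nu>)"
proof -
  define I where "I = {1..n}"
  define P where "P = {\<rho>. \<rho> permutes I}"
  define S where "S \<rho> = {g \<in> sym_on X. \<forall>i\<in>I. g ` A i = A (\<rho> i)}" for \<rho>
  note A = assms(4)[folded I_def]
  have A_inj: "i = j" if "A i = A j" "i \<in> I" "j \<in> I" for i j
    using A that by (auto simp: bij_betw_def inj_on_def)
  have A_in: "A i \<in> \<Gamma>" if "i \<in> I" for i
    using A that by (auto simp: bij_betw_def)
  have P_in: "\<rho> i \<in> I" if "\<rho> \<in> P" "i \<in> I" for \<rho> i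
    using that by (simp add: P_def permutes_in_image)

  have entry: "canonical_matrix X \<mu> \<nu> i j = {g \<in> sym_on X. g ` A i = A j}"
    if "i \<in> I" "j \<in> I" for i j
  proof -
    have "card {\<mu> j, \<nu> j} = 2"
      using A_in[OF that(2)] assms(2) assms(5)[of j] that(2) by (auto simp: graph_on_def I_def)
    then have "\<mu> j \<noteq> \<nu> j" by auto
    moreover have "A i = {\<mu> i, \<nu> i}" "A j = {\<mu> j, \<nu> j}"
      using assms(5) that by (simp_all add: I_def)
    ultimately show ?thesis
      using canonical_matrix_eq[of \<mu> j \<nu> X i] by simp
  qed
  have summand: "(\<Otimes>\<^bsub>partials_ring X\<^esub>i\<in>I. canonical_matrix X \<mu> \<nu> i (\<rho> i)) = S \<rho>" if "\<rho> \<in> P" for \<rho>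
  proof -
    have "(\<Otimes>\<^bsub>partials_ring X\<^esub>i\<in>I. canonical_matrix X \<mu> \<nu> i (\<rho> i))
        = {g \<in> sym_on X. \<forall>i\<in>I. g \<in> canonical_matrix X \<mu> \<nu> i (\<rho> i)}"
    proof (rule finprod_partials_ring)
      show "finite I" by (simp add: I_def)
      show "canonical_matrix X \<mu> \<nu> i (\<rho> i) \<subseteq> sym_on X" if "i \<in> I" for i
        using entry[OF that P_in[OF \<open>\<rho> \<in> P\<close> that]] by blast
    qed
    also have "\<dots> = S \<rho>"
    proof -
      have "g \<in> canonical_matrix X \<mu> \<nu> i (\<rho> i) \<longleftrightarrow> g ` A i = A (\<rho> i)"
        if "g \<in> sym_on X" "i \<in> I" for g i
        using entry[OF that(2) P_in[OF \<open>\<rho> \<in> P\<close> that(2)]] that(1) by simp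
      then show ?thesis by (auto simp: S_def)
    qed
    finally show ?thesis .
  qed

  have disjoint: "disjoint_family_on S P"
    unfolding disjoint_family_on_def
  proof (intro ballI impI)
    fix \<rho> \<sigma> assume \<rho>: "\<rho> \<in> P" and \<sigma>: "\<sigma> \<in> P" and neq: "\<rho> \<noteq> \<sigma>"
    have False if "g \<in> S \<rho>" "g \<in> S \<sigma>" for g
    proof -
      have "\<rho> i = \<sigma> i" for i
      proof (cases "i \<in> I")
        case True
        then have "A (\<rho> i) = A (\<sigma> i)" using that by (auto simp: S_def)
        then show ?thesis using A_inj P_in \<rho> \<sigma> True by blast
      next
        case False
        then show ?thesis using \<rho> \<sigma> by (simp add: P_def permutes_not_in)
      qed
      then show False using neq by blast
    qed
    then show "S \<rho> \<inter> S \<sigma> = {}" by blast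
  qed
  have "partials_det X n (canonical_matrix X \<mu> \<nu>)
      = (\<Oplus>\<^bsub>partials_ring X\<^esub>\<rho>\<in>P. \<Otimes>\<^bsub>partials_ring X\<^esub>i\<in>I. canonical_matrix X \<mu> \<nu> i (\<rho> i))"
    by (simp add: partials_det_def P_def I_def)
  also have "\<dots> = (\<Oplus>\<^bsub>partials_ring X\<^esub>\<rho>\<in>P. S \<rho>)"
  proof -
    interpret cring "partials_ring X" by (rule cring_partials_ring)
    have "S \<in> P \<rightarrow> carrier (partials_ring X)" by (auto simp: S_def partials_ring_def)
    then show ?thesis using summand by (intro finsum_cong') auto
  qed
  also have "\<dots> = (\<Union>\<rho>\<in>P. S \<rho>)"
  proof (rule finsum_partials_ring_disjoint[OF _ _ disjoint])
    show "finite P" by (simp add: P_def I_def finite_permutations)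
    show "S \<rho> \<subseteq> sym_on X" for \<rho> by (auto simp: S_def)
  qed
  also have "\<dots> = Aut X \<Gamma>"
  proof (intro equalityI subsetI)
    fix g assume "g \<in> (\<Union>\<rho>\<in>P. S \<rho>)"
    then obtain \<rho> where \<rho>: "\<rho> \<in> P" and g: "g \<in> S \<rho>" by blast
    have "g ` A i \<in> \<Gamma>" if "i \<in> I" for i
      using g A_in[OF P_in[OF \<rho> that]] that by (simp add: S_def)
    then have "\<forall>B\<in>\<Gamma>. g ` B \<in> \<Gamma>"
      using bij_betw_imp_surj_on[OF A] by blast
    then show "g \<in> Aut X \<Gamma>"
      using g by (simp add: S_def Aut_def)
  next
    fix g assume g: "g \<in> Aut X \<Gamma>"
    then have "inj g" by (auto simp: Aut_def sym_on_def intro: permutes_inj)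
    then have inj: "inj_on ((`) g) \<Gamma>" by (simp add: inj_on_def inj_image_eq_iff)
    have stable: "(`) g ` \<Gamma> \<subseteq> \<Gamma>" using g by (auto simp: Aut_def)
    have "finite I" by (simp add: I_def)
    then obtain \<rho> where \<rho>: "\<rho> permutes I" "\<forall>i\<in>I. g ` A i = A (\<rho> i)"
      using permutation_of_indices[OF _ A inj stable] by blast
    then have "g \<in> S \<rho>" using g by (simp add: S_def Aut_def)
    then show "g \<in> (\<Union>\<rho>\<in>P. S \<rho>)" using \<rho>(1) unfolding P_def by blast
  qed
  finally show ?thesis by (rule sym)
qed

end
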